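(* Let $A\in\mathbb{R}^{n\times n}$. Then $$\frac{1}{n}\,\sigma_{\min}(A)\le r(A)\le \sigma_{\min}(A),$$ where $\sigma_{\min}(A)$ is the smallest singular value of $A$.
   Context: The regularity radius of $A$ is $r(A)=\min\{\delta\ge 0 : [A-\delta ee^T,A+\delta ee^T]\text{ is singular}\}$, where $e=(1,\dots,1)^T$, $[A-\delta ee^T,A+\delta ee^T]$ is the set of all real matrices $A'$ with $A-\delta ee^T\le A'\le A+\delta ee^T$ entrywise, and this set is called singular if it contains at least one singular matrix. *)

theory Defs
  imports "HOL-Analysis.Analysis"
begin

definition eigenvalue :: "real^'n^'n \<Rightarrow> real \<Rightarrow> bool" where
  "eigenvalue M l \<longleftrightarrow> (\<exists>v. v \<noteq> 0 \<and> M *v v = l *\<^sub>R v)"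

definition singular_values :: "real^'n^'n \<Rightarrow> real set" where
  "singular_values A = {sqrt l | l. eigenvalue (transpose A ** A) l}"

definition sigma_min :: "real^'n^'n \<Rightarrow> real" where
  "sigma_min A = Min (singular_values A)"

text \<open>The constant \<open>1\<close> of type \<open>real^'n\<close> is the vector \<open>e\<close> with all entries 1.\<close>

definition outer :: "real^'n \<Rightarrow> real^'n \<Rightarrow> real^'n^'n" where
  "outer u v = (\<chi> i j. u $ i * v $ j)"

text \<open>The order on \<open>real^'n^'n\<close> is the entrywise one, so \<open>{L..U}\<close> is an interval matrix.\<close>

definition singular_set :: "(real^'n^'n) set \<Rightarrow> bool" where
  "singular_set S \<longleftrightarrow> (\<exists>M\<in>S. \<not> invertible M)"

definition regularity_radius :: "real^'n^'n \<Rightarrow> real" where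
  "regularity_radius A =
     (LEAST d. 0 \<le> d \<and> singular_set {A - d *\<^sub>R outer 1 1 .. A + d *\<^sub>R outer 1 1})"

end

theory Submission
  imports Defs
begin

text \<open>
  The minimum of \<open>norm (A *v x)\<close> over the unit sphere is attained at some \<open>x\<close>, and by the
  variational argument \<open>x\<close> is an eigenvector of \<open>A\<^sup>T A\<close>, so this minimum is \<open>\<sigma>\<^sub>m\<^sub>i\<^sub>n\<close>.
  For the upper bound, subtract the rank-one matrix \<open>(A x) x\<^sup>T\<close>: the result annihilates \<open>x\<close>, and
  the entries of the correction are at most \<open>norm (A *v x)\<close>.
  For the lower bound, if \<open>M x = 0\<close> with \<open>x\<close> a unit vector, then \<open>norm (A *v x)\<close> equals
  \<open>norm ((A - M) *v x)\<close>, which is at most \<open>n\<close> times the largest entry of \<open>A - M\<close>.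
\<close>

lemma inner_transpose_matrix_mult:
  fixes A :: "real^'n^'m"
  shows "((transpose A ** A) *v x) \<bullet> y = (A *v x) \<bullet> (A *v y)"
  by (simp add: matrix_vector_mul_assoc[symmetric] transpose_matrix_vector dot_lmul_matrix)

text \<open>\<open>sigma_min\<close> takes a \<open>Min\<close>, which is meaningful only on a
  finite set. Symmetry of the Gram matrix makes eigenvectors for distinct eigenvalues orthogonal,
  and a pairwise orthogonal set is finite.\<close>

lemma finite_eigenvalues_gram:
  fixes A :: "real^'n^'n"
  shows "finite {l. eigenvalue (transpose A ** A) l}"
proof -
  let ?B = "transpose A ** A" and ?E = "{l. eigenvalue (transpose A ** A) l}"
  have "\<forall>l\<in>?E. \<exists>v. v \<noteq> 0 \<and> ?B *v v = l *\<^sub>R v"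
    by (simp add: eigenvalue_def)
  from bchoice[OF this] obtain v
    where v: "\<And>l. l \<in> ?E \<Longrightarrow> v l \<noteq> 0 \<and> ?B *v v l = l *\<^sub>R v l"
    by blast
  have orth: "v k \<bullet> v l = 0" if "k \<in> ?E" "l \<in> ?E" "k \<noteq> l" for k l
  proof -
    have "k * (v k \<bullet> v l) = (?B *v v k) \<bullet> v l"
      using v[OF that(1)] by simp
    also have "\<dots> = (?B *v v l) \<bullet> v k"
      unfolding inner_transpose_matrix_mult by (rule inner_commute)
    also have "\<dots> = l * (v k \<bullet> v l)"
      using v[OF that(2)] by (simp add: inner_commute)
    finally show ?thesis using that(3) by simp
  qed
  \<comment> \<open>A vector chosen for two distinct eigenvalues would be orthogonal to itself,
    hence zero.\<close>
  have "inj_on v ?E"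
    by (intro inj_onI) (metis orth v inner_eq_zero_iff)
  moreover have "finite (v ` ?E)"
    by (rule pairwise_orthogonal_imp_finite) (auto simp: pairwise_def orthogonal_def intro: orth)
  ultimately show ?thesis
    by (metis finite_imageD)
qed

text \<open>Moving from \<open>x\<close> by \<open>t\<close> along the residual \<open>w\<close>
  changes the nonnegative gap between \<open>(norm (A *v y))\<^sup>2\<close> and
  \<open>s\<^sup>2 * (norm y)\<^sup>2\<close>, which is zero at \<open>x\<close>, into
  \<open>2 * t * b + t\<^sup>2 * c\<close> with \<open>b = w \<bullet> w\<close>. A nonzero linear
  term would make this negative for some \<open>t\<close>.\<close>

lemma norm_minimizer_is_eigenvector:
  fixes A :: "real^'n^'n"
  assumes x: "norm x = 1" and low: "\<And>y. norm (A *v x) * norm y \<le> norm (A *v y)"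
  shows "(transpose A ** A) *v x = (norm (A *v x))\<^sup>2 *\<^sub>R x"
proof (rule ccontr)
  define s where "s = norm (A *v x)"
  define w where "w = (transpose A ** A) *v x - s\<^sup>2 *\<^sub>R x"
  define b where "b = w \<bullet> w"
  define c where "c = (norm (A *v w))\<^sup>2 - s\<^sup>2 * (norm w)\<^sup>2"
  assume "(transpose A ** A) *v x \<noteq> (norm (A *v x))\<^sup>2 *\<^sub>R x"
  then have "b > 0" by (simp add: b_def w_def s_def)
  have sq: "s\<^sup>2 * (norm y)\<^sup>2 \<le> (norm (A *v y))\<^sup>2" for y
    using power_mono[OF low[of y], of 2] by (simp add: s_def power_mult_distrib)
  then have "c \<ge> 0" by (simp add: c_def)
  have b: "b = (A *v x) \<bullet> (A *v w) - s\<^sup>2 * (x \<bullet> w)"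
    unfolding inner_transpose_matrix_mult[symmetric] b_def
    by (subst (1) w_def) (simp add: inner_diff_left)
  have quad: "0 \<le> 2 * t * b + t\<^sup>2 * c" for t
  proof -
    have xx: "x \<bullet> x = 1" "(A *v x) \<bullet> (A *v x) = s\<^sup>2"
      using x by (simp_all add: s_def power2_norm_eq_inner[symmetric])
    have "A *v (x + t *\<^sub>R w) = A *v x + t *\<^sub>R (A *v w)"
      by (simp add: matrix_vector_right_distrib matrix_vector_mult_scaleR)
    then have "0 \<le> (norm (A *v x + t *\<^sub>R (A *v w)))\<^sup>2 - s\<^sup>2 * (norm (x + t *\<^sub>R w))\<^sup>2"
      using sq[of "x + t *\<^sub>R w"] by simp
    also have "\<dots> = 2 * t * b + t\<^sup>2 * c"
      by (simp add: power2_norm_eq_inner inner_add_left inner_add_right xx b c_def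
          inner_commute[of w x] inner_commute[of "A *v w" "A *v x"])
        (simp add: algebra_simps power2_eq_square)
    finally show ?thesis .
  qed
  \<comment> \<open>The denominator is \<open>c + 1\<close> because \<open>c\<close> may be zero;
    the quadratic then equals \<open>- (t\<^sup>2 * (c + 2))\<close>.\<close>
  define t where "t = - b / (c + 1)"
  have b_eq: "b = - t * (c + 1)" and "t \<noteq> 0"
    using \<open>b > 0\<close> \<open>c \<ge> 0\<close> by (simp_all add: t_def)
  have "2 * t * b + t\<^sup>2 * c = - (t\<^sup>2 * (c + 2))"
    unfolding b_eq by (simp add: algebra_simps power2_eq_square)
  moreover have "t\<^sup>2 * (c + 2) > 0"
    using \<open>t \<noteq> 0\<close> \<open>c \<ge> 0\<close> by (intro mult_pos_pos) auto
  ultimately show False using quad[of t] by linarith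
qed

lemma sigma_min_attained:
  fixes A :: "real^'n^'n"
  obtains x where "norm x = 1" "norm (A *v x) = sigma_min A"
    "\<And>y. sigma_min A * norm y \<le> norm (A *v y)"
proof -
  have "sphere (0 :: real^'n) 1 \<noteq> {}"
    using vector_choose_size[of 1] by auto
  moreover have "continuous_on (sphere 0 1) (\<lambda>x. norm (A *v x))"
    by (intro continuous_intros linear_continuous_on matrix_vector_mul_bounded_linear)
  ultimately obtain x where x: "norm x = 1" "\<And>y. norm y = 1 \<Longrightarrow> norm (A *v x) \<le> norm (A *v y)"
    using continuous_attains_inf[OF compact_sphere, of "0 :: real^'n" 1 "\<lambda>x. norm (A *v x)"]
    by auto
  define s where "s = norm (A *v x)"
  have low: "s * norm y \<le> norm (A *v y)" for y
  proof (cases "y = 0")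
    case False
    then have "s \<le> norm (A *v ((1 / norm y) *\<^sub>R y))"
      unfolding s_def by (intro x(2)) simp
    then show ?thesis
      using False by (simp add: matrix_vector_mult_scaleR field_simps)
  qed simp
  have "eigenvalue (transpose A ** A) (s\<^sup>2)"
    unfolding eigenvalue_def
    using norm_minimizer_is_eigenvector[OF x(1) low[unfolded s_def]] x(1)
    by (auto simp: s_def intro!: exI[of _ x])
  moreover have "sqrt (s\<^sup>2) = s"
    by (simp add: s_def)
  ultimately have mem: "s \<in> singular_values A"
    unfolding singular_values_def mem_Collect_eq by metis
  \<comment> \<open>On an eigenvector \<open>v\<close> for \<open>l\<close>, the square of
    \<open>norm (A *v v)\<close> is \<open>l * (norm v)\<^sup>2\<close>, so \<open>low\<close> gives
    \<open>s\<^sup>2 \<le> l\<close>.\<close>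
  have least: "s \<le> sqrt l" if "eigenvalue (transpose A ** A) l" for l
  proof -
    from that obtain v where v: "v \<noteq> 0" "(transpose A ** A) *v v = l *\<^sub>R v"
      unfolding eigenvalue_def by blast
    have "s\<^sup>2 * (norm v)\<^sup>2 \<le> (norm (A *v v))\<^sup>2"
      using power_mono[OF low[of v], of 2] by (simp add: s_def power_mult_distrib)
    also have "\<dots> = l * (norm v)\<^sup>2"
      using inner_transpose_matrix_mult[of A v v] v(2) by (simp add: power2_norm_eq_inner)
    finally show ?thesis
      using v(1) by (intro real_le_rsqrt) simp
  qed
  have "singular_values A = sqrt ` {l. eigenvalue (transpose A ** A) l}"
    by (auto simp: singular_values_def)
  then have "sigma_min A = s"
    unfolding sigma_min_def
    using finite_eigenvalues_gram[of A] mem least by (intro Min_eqI) auto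
  then show thesis
    using that[of x] x(1) low s_def by simp
qed

lemma outer_mult_vector: "outer u v *v w = (v \<bullet> w) *\<^sub>R u"
  by (simp add: vec_eq_iff outer_def matrix_vector_mult_def inner_vec_def sum_distrib_left mult_ac)

lemma mem_interval_matrix_iff:
  fixes A M :: "real^'n^'n"
  shows "M \<in> {A - d *\<^sub>R outer 1 1 .. A + d *\<^sub>R outer 1 1} \<longleftrightarrow> (\<forall>i j. \<bar>A $ i $ j - M $ i $ j\<bar> \<le> d)"
  by (auto simp: less_eq_vec_def outer_def abs_le_iff algebra_simps)

text \<open>The factor n arises as a product of two square roots: one from the norm of a row, used
  in Cauchy-Schwarz for each component, the other from the norm of a vector with n bounded
  components.\<close>

lemma norm_matrix_vector_mult_le_entry_bound:
  fixes B :: "real^'n^'n"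
  assumes B: "\<And>i j. \<bar>B $ i $ j\<bar> \<le> d"
  shows "norm (B *v x) \<le> real CARD('n) * d * norm x"
proof -
  have "norm (B $ i) \<le> sqrt (real CARD('n)) * d" for i
  proof -
    have "0 \<le> d" using B[of i i] by linarith
    have "norm (B $ i) \<le> L2_set (\<lambda>_. d) (UNIV :: 'n set)"
      unfolding norm_vec_def by (intro L2_set_mono) (use B in auto)
    also have "\<dots> = sqrt (real CARD('n)) * d"
      using \<open>0 \<le> d\<close> by (simp add: L2_set_def real_sqrt_mult)
    finally show ?thesis .
  qed
  then have entry: "\<bar>(B *v x) $ i\<bar> \<le> sqrt (real CARD('n)) * d * norm x" for i
    by (metis Cauchy_Schwarz_ineq2 matrix_vector_mul_component mult_right_mono norm_ge_zero order_trans)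
  then have nonneg: "0 \<le> sqrt (real CARD('n)) * d * norm x"
    by (meson abs_ge_zero order_trans)
  have "norm (B *v x) \<le> L2_set (\<lambda>_. sqrt (real CARD('n)) * d * norm x) (UNIV :: 'n set)"
    by (subst norm_vec_def, intro L2_set_mono) (use entry in auto)
  also have "\<dots> = sqrt (real CARD('n)) * (sqrt (real CARD('n)) * d * norm x)"
    by (simp only: L2_set_def sum_constant real_sqrt_mult real_sqrt_abs abs_of_nonneg[OF nonneg])
  also have "\<dots> = real CARD('n) * d * norm x"
    by (simp add: mult.assoc[symmetric])
  finally show ?thesis .
qed

text \<open>\<open>LEAST\<close> over the reals says something only if the minimum is attained.
  Compactness provides this as soon as one admissible radius \<open>s\<close> is known.\<close>

lemma regularity_radius_is_least:
  fixes A :: "real^'n^'n"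
  defines "sing \<equiv> \<lambda>d. singular_set {A - d *\<^sub>R outer 1 1 .. A + d *\<^sub>R outer 1 1}"
  assumes s: "0 \<le> s" "sing s"
  shows "0 \<le> regularity_radius A" "sing (regularity_radius A)" "regularity_radius A \<le> s"
proof -
  \<comment> \<open>Pairing each radius with a singular witness turns the existential condition into
    a closed one, and the cut-off at \<open>s\<close> makes the set bounded.\<close>
  define T where
    "T = {p :: real \<times> (real^'n^'n). 0 \<le> fst p \<and> fst p \<le> s \<and> det (snd p) = 0 \<and>
            (\<forall>i j. \<bar>A $ i $ j - snd p $ i $ j\<bar> \<le> fst p)}"
  have sing_iff: "sing d \<longleftrightarrow> (\<exists>M. det M = 0 \<and> (\<forall>i j. \<bar>A $ i $ j - M $ i $ j\<bar> \<le> d))" for d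
    unfolding sing_def singular_set_def Bex_def mem_interval_matrix_iff
    by (auto simp: invertible_det_nz)
  \<comment> \<open>Expanded by \<open>det_def\<close>, the determinant is a polynomial in the
    entries, hence continuous.\<close>
  have "closed T"
    unfolding T_def det_def
    by (intro closed_Collect_conj closed_Collect_all closed_Collect_le closed_Collect_eq
        continuous_intros)
  moreover have "T \<subseteq> {0..s} \<times> {A - s *\<^sub>R outer 1 1 .. A + s *\<^sub>R outer 1 1}"
    unfolding subset_iff mem_Times_iff mem_interval_matrix_iff T_def by (auto intro: order_trans)
  moreover have "compact ({0..s} \<times> {A - s *\<^sub>R outer 1 1 .. A + s *\<^sub>R outer 1 1})"
    by (simp add: compact_Times compact_interval)
  ultimately have "compact T"
    by (metis compact_Int_closed inf.absorb_iff2)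
  moreover have "T \<noteq> {}"
    using s unfolding sing_iff T_def by auto
  ultimately obtain p where p: "p \<in> T" "\<And>q. q \<in> T \<Longrightarrow> fst p \<le> fst q"
    using continuous_attains_inf[of T fst] continuous_on_fst[OF continuous_on_id] by blast
  have p1: "0 \<le> fst p" "sing (fst p)" "fst p \<le> s"
    using p(1) unfolding sing_iff T_def by auto
  \<comment> \<open>Radii beyond the cut-off exceed \<open>s\<close> and hence \<open>fst p\<close>,
    so the minimum over \<open>T\<close> is global.\<close>
  have "fst p \<le> d" if "0 \<le> d" "sing d" for d
  proof (cases "d \<le> s")
    case True
    from that(2) obtain M where "det M = 0" "\<forall>i j. \<bar>A $ i $ j - M $ i $ j\<bar> \<le> d"
      unfolding sing_iff by blast
    then have "(d, M) \<in> T" using that(1) True by (simp add: T_def)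
    then show ?thesis using p(2) by fastforce
  qed (use p1 in simp)
  then have "regularity_radius A = fst p"
    unfolding regularity_radius_def using p1 by (intro Least_equality) (auto simp: sing_def)
  then show "0 \<le> regularity_radius A" "sing (regularity_radius A)" "regularity_radius A \<le> s"
    using p1 by simp_all
qed

theorem mainTheorem5:
  fixes A :: "real^'n^'n"
  shows "1 / real CARD('n) * sigma_min A \<le> regularity_radius A \<and>
         regularity_radius A \<le> sigma_min A"
proof -
  obtain x where x: "norm x = 1" "norm (A *v x) = sigma_min A"
    and low: "\<And>y. sigma_min A * norm y \<le> norm (A *v y)"
    using sigma_min_attained[of A] by blast
  have "0 \<le> sigma_min A"
    using x(2) by (metis norm_ge_zero)
  define M where "M = A - outer (A *v x) x"
  have "M *v x = 0"
    using x(1) by (simp add: M_def outer_mult_vector matrix_vector_mult_diff_rdistrib power2_norm_eq_inner[symmetric])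
  moreover have "x \<noteq> 0" using x(1) by auto
  ultimately have "\<not> invertible M"
    by (metis invertible_def matrix_left_invertible_ker)
  moreover have "\<bar>A $ i $ j - M $ i $ j\<bar> \<le> sigma_min A" for i j
    using mult_mono[OF component_le_norm_cart[of "A *v x" i] component_le_norm_cart[of x j]] x \<open>0 \<le> sigma_min A\<close>
    by (simp add: M_def outer_def abs_mult)
  ultimately have
    "singular_set {A - sigma_min A *\<^sub>R outer 1 1 .. A + sigma_min A *\<^sub>R outer 1 1}"
    unfolding singular_set_def Bex_def mem_interval_matrix_iff by blast
  note least = regularity_radius_is_least[OF \<open>0 \<le> sigma_min A\<close> this]
  let ?r = "regularity_radius A"
  \<comment> \<open>Since the minimum is attained, a singular matrix exists at radius exactly
    \<open>?r\<close>, so no limiting argument over larger radii arises.\<close>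
  obtain N where N: "\<not> invertible N" "\<And>i j. \<bar>A $ i $ j - N $ i $ j\<bar> \<le> ?r"
    using least(2) unfolding singular_set_def Bex_def mem_interval_matrix_iff by blast
  obtain y where y: "y \<noteq> 0" "N *v y = 0"
    using N(1) by (metis invertible_left_inverse matrix_left_invertible_ker)
  have "sigma_min A * norm y \<le> norm ((A - N) *v y)"
    using low[of y] y(2) by (simp add: matrix_vector_mult_diff_rdistrib)
  also have "\<dots> \<le> real CARD('n) * ?r * norm y"
    by (rule norm_matrix_vector_mult_le_entry_bound) (simp add: N(2))
  finally have "sigma_min A \<le> real CARD('n) * ?r"
    using y(1) by simp
  then show ?thesis
    using least(3) by (simp add: field_simps)
qed

end
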